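(* Let $P$ be any one of the following properties of commutative cancellative monoids: (1) atomic; (2) bounded factorizations (BF); (3) finite factorizations (FF); (4) half-factorial; (5) factorial; (6) $v$-Noetherian; (7) Krull. Then $P$ cannot be formulated as a first-order statement in the language of monoids; that is, there is no first-order sentence $\varphi$ in the language $\{\cdot,1\}$ (with equality) such that for every commutative cancellative monoid $H$: $H$ satisfies $\varphi$ if and only if $H$ has property $P$.
   Context: Let $H$ be a commutative cancellative monoid with unit group $H^\times$ and quotient group $q(H)$. An atom is a non-unit $a$ such that $a=bc$ implies $b\in H^\times$ or $c\in H^\times$. Elements $a,b$ are associated if $a=\varepsilon b$ with $\varepsilon\in H^\times$. A factorization of $a$ of length $\ell$ is an expression $a=u_1\cdots u_\ell$ with atoms $u_i$; two factorizations are essentially the same if they have the same length and agree up to order and associates. The set of lengths $L(a)$ is the set of lengths of factorizations of $a$. $H$ is atomic if every non-unit has a factorization. $H$ is BF if it is atomic and $L(a)$ is finite for every non-unit $a$. $H$ is FF if it is atomic and every non-unit has only finitely many factorizations up to being essentially the same. $H$ is half-factorial if it is atomic and $L(a)$ is a singleton for every non-unit $a$. $H$ is factorial if it is atomic and any two factorizations of an element are essentially the same. For $X\subseteq q(H)$ put $(H:X)=\{z\in q(H)\mid zX\subseteq H\}$ and $X_v=(H:(H:X))$; a $v$-ideal of $H$ is a subset $X\subseteq H$ with $X_v=X$. $H$ is $v$-Noetherian if it satisfies the ascending chain condition on $v$-ideals. $H$ is Krull if it is $v$-Noetherian and completely integrally closed, the latter meaning that every $x\in q(H)$ for which there is $c\in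 H$ with $cx^n\in H$ for all $n\in\mathbb N$ lies in $H$. *)

theory Defs
  imports "HOL-Algebra.Divisibility"
begin

section \<open>First-order logic with equality over the signature of monoids\<close>

datatype mon_term = Var nat | One | Mult mon_term mon_term

datatype mon_form =
    Eq mon_term mon_term
  | Neg mon_form
  | Conj mon_form mon_form
  | Forall nat mon_form

primrec term_vars :: "mon_term \<Rightarrow> nat set" where
  "term_vars (Var n) = {n}"
| "term_vars One = {}"
| "term_vars (Mult s t) = term_vars s \<union> term_vars t"

primrec free_vars :: "mon_form \<Rightarrow> nat set" where
  "free_vars (Eq s t) = term_vars s \<union> term_vars t"
| "free_vars (Neg \<phi>) = free_vars \<phi>"
| "free_vars (Conj \<phi> \<psi>) = free_vars \<phi> \<union> free_vars \<psi>"
| "free_vars (Forall n \<phi>) = free_vars \<phi> - {n}"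

definition sentence :: "mon_form \<Rightarrow> bool" where
  "sentence \<phi> \<longleftrightarrow> free_vars \<phi> = {}"

primrec term_val :: "('a, 'b) monoid_scheme \<Rightarrow> (nat \<Rightarrow> 'a) \<Rightarrow> mon_term \<Rightarrow> 'a" where
  "term_val H v (Var n) = v n"
| "term_val H v One = \<one>\<^bsub>H\<^esub>"
| "term_val H v (Mult s t) = term_val H v s \<otimes>\<^bsub>H\<^esub> term_val H v t"

primrec holds :: "('a, 'b) monoid_scheme \<Rightarrow> (nat \<Rightarrow> 'a) \<Rightarrow> mon_form \<Rightarrow> bool" where
  "holds H v (Eq s t) \<longleftrightarrow> term_val H v s = term_val H v t"
| "holds H v (Neg \<phi>) \<longleftrightarrow> \<not> holds H v \<phi>"
| "holds H v (Conj \<phi> \<psi>) \<longleftrightarrow> holds H v \<phi> \<and> holds H v \<psi>"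
| "holds H v (Forall n \<phi>) \<longleftrightarrow> (\<forall>x\<in>carrier H. holds H (v(n := x)) \<phi>)"

definition satisfies :: "('a, 'b) monoid_scheme \<Rightarrow> mon_form \<Rightarrow> bool" (infix \<open>\<Turnstile>\<close> 50) where
  "H \<Turnstile> \<phi> \<longleftrightarrow> (\<forall>v. range v \<subseteq> carrier H \<longrightarrow> holds H v \<phi>)"

lemma term_val_cong:
  "(\<And>n. n \<in> term_vars t \<Longrightarrow> v n = w n) \<Longrightarrow> term_val H v t = term_val H w t"
  by (induction t) auto

lemma holds_cong:
  "(\<And>n. n \<in> free_vars \<phi> \<Longrightarrow> v n = w n) \<Longrightarrow> holds H v \<phi> \<longleftrightarrow> holds H w \<phi>"
proof (induction \<phi> arbitrary: v w)
  case (Eq s t)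
  then show ?case using term_val_cong[of s v w H] term_val_cong[of t v w H] by simp
next
  case (Neg \<phi>)
  have "holds H v \<phi> \<longleftrightarrow> holds H w \<phi>"
    by (rule Neg.IH) (rule Neg.prems, simp)
  then show ?case by simp
next
  case (Conj \<phi> \<psi>)
  have "holds H v \<phi> \<longleftrightarrow> holds H w \<phi>"
    by (rule Conj.IH) (rule Conj.prems, simp)
  moreover have "holds H v \<psi> \<longleftrightarrow> holds H w \<psi>"
    by (rule Conj.IH) (rule Conj.prems, simp)
  ultimately show ?case by simp
next
  case (Forall n \<phi>)
  have "holds H (v(n := x)) \<phi> \<longleftrightarrow> holds H (w(n := x)) \<phi>" for x
    by (rule Forall.IH) (simp add: Forall.prems)
  then show ?case by simp
qed

lemma sentence_satisfies_iff:
  assumes "sentence \<phi>" and "range v \<subseteq> carrier H"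
  shows "H \<Turnstile> \<phi> \<longleftrightarrow> holds H v \<phi>"
proof -
  have "holds H w \<phi> \<longleftrightarrow> holds H v \<phi>" for w
    by (rule holds_cong) (use assms(1) in \<open>simp add: sentence_def\<close>)
  then show ?thesis using assms(2) by (auto simp: satisfies_def)
qed


section \<open>Factorizations\<close>

text \<open>
  Atoms, associated elements and factorizations being essentially the same are the notions
  \<^const>\<open>irreducible\<close>, \<^const>\<open>associated\<close> and \<^const>\<open>essentially_equal\<close> of
  \<^theory>\<open>HOL-Algebra.Divisibility\<close>. The library phrases the first two through divisibility;
  the next two lemmas give the usual formulations in terms of units.
\<close>

lemma (in comm_monoid_cancel) irreducible_iff_atom:
  assumes a: "a \<in> carrier G"
  shows "irreducible G a \<longleftrightarrow> a \<notin> Units G \<and>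
    (\<forall>b\<in>carrier G. \<forall>c\<in>carrier G. a = b \<otimes> c \<longrightarrow> b \<in> Units G \<or> c \<in> Units G)"
    (is "?L \<longleftrightarrow> ?R")
proof
  assume ?L
  then have "b \<in> Units G \<or> c \<in> Units G"
    if "b \<in> carrier G" "c \<in> carrier G" "a = b \<otimes> c" for b c
    using that irreducible_prodE[of b c] by metis
  then show ?R using \<open>?L\<close> by (auto simp: irreducible_def)
next
  assume R: ?R
  show ?L
  proof (rule irreducibleI)
    show "a \<notin> Units G" using R by blast
  next
    fix b assume b: "b \<in> carrier G" and pf: "properfactor G b a"
    then obtain c where c: "c \<in> carrier G" "a = b \<otimes> c"
      by (auto simp: properfactor_def factor_def)
    have "c \<notin> Units G"
    proof
      assume "c \<in> Units G"
      then have "a \<sim> b" using c b by (intro associatedI2) auto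
      then show False using pf by (auto simp: properfactor_def associated_def)
    qed
    then show "b \<in> Units G" using R b c by blast
  qed
qed

lemma (in comm_monoid_cancel) associated_iff_unit:
  assumes "a \<in> carrier G" and "b \<in> carrier G"
  shows "a \<sim> b \<longleftrightarrow> (\<exists>u\<in>Units G. a = u \<otimes> b)"
proof
  assume "a \<sim> b"
  then obtain u where "u \<in> Units G" "a = b \<otimes> u" using associatedD2 assms by blast
  then show "\<exists>u\<in>Units G. a = u \<otimes> b" using assms by (intro bexI[of _ u]) (auto simp: m_comm)
next
  assume "\<exists>u\<in>Units G. a = u \<otimes> b"
  then obtain u where "u \<in> Units G" "a = b \<otimes> u" using assms m_comm[of _ b] by auto
  then show "a \<sim> b" using assms by (intro associatedI2)
qed

definition factorizations :: "('a, 'b) monoid_scheme \<Rightarrow> 'a \<Rightarrow> 'a list set" where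
  "factorizations H a = {fs. set fs \<subseteq> carrier H \<and> factors H fs a}"

definition lengths :: "('a, 'b) monoid_scheme \<Rightarrow> 'a \<Rightarrow> nat set" where
  "lengths H a = length ` factorizations H a"

definition ess_same :: "('a, 'b) monoid_scheme \<Rightarrow> 'a \<Rightarrow> ('a list \<times> 'a list) set" where
  "ess_same H a =
    {(fs, gs) \<in> factorizations H a \<times> factorizations H a. essentially_equal H fs gs}"

definition atomic :: "('a, 'b) monoid_scheme \<Rightarrow> bool" where
  "atomic H \<longleftrightarrow> (\<forall>a\<in>carrier H - Units H. factorizations H a \<noteq> {})"

definition BF :: "('a, 'b) monoid_scheme \<Rightarrow> bool" where
  "BF H \<longleftrightarrow> atomic H \<and> (\<forall>a\<in>carrier H - Units H. finite (lengths H a))"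

definition FF :: "('a, 'b) monoid_scheme \<Rightarrow> bool" where
  "FF H \<longleftrightarrow> atomic H \<and>
    (\<forall>a\<in>carrier H - Units H. finite (factorizations H a // ess_same H a))"

definition half_factorial :: "('a, 'b) monoid_scheme \<Rightarrow> bool" where
  "half_factorial H \<longleftrightarrow> atomic H \<and> (\<forall>a\<in>carrier H - Units H. is_singleton (lengths H a))"

lemma (in comm_monoid_cancel) equiv_ess_same: "equiv (factorizations G a) (ess_same G a)"
proof (rule equivI)
  show "ess_same G a \<subseteq> factorizations G a \<times> factorizations G a"
    by (auto simp: ess_same_def)
  show "refl_on (factorizations G a) (ess_same G a)"
    by (auto simp: refl_on_def ess_same_def factorizations_def)
  show "sym (ess_same G a)"
    using ee_sym by (auto simp: sym_def ess_same_def factorizations_def)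
  show "trans (ess_same G a)"
  proof (rule transI)
    fix x y z
    assume "(x, y) \<in> ess_same G a" "(y, z) \<in> ess_same G a"
    then show "(x, z) \<in> ess_same G a"
      using ee_trans[of x y z] by (simp add: ess_same_def factorizations_def)
  qed
qed

text \<open>
  Factoriality is the library locale \<^locale>\<open>factorial_monoid\<close>. Its uniqueness axiom only
  speaks about non-units; the only factorization of a unit is the empty one of \<open>\<one>\<close>.
\<close>

lemma (in comm_monoid_cancel) factorial_monoid_iff:
  "factorial_monoid G \<longleftrightarrow> atomic G \<and>
    (\<forall>a\<in>carrier G. \<forall>fs\<in>factorizations G a. \<forall>gs\<in>factorizations G a. essentially_equal G fs gs)"
    (is "?L \<longleftrightarrow> ?R")
proof
  assume ?L
  then interpret factorial_monoid G .
  have unit: "fs = []" if "a \<in> Units G" "fs \<in> factorizations G a" for a fs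
  proof (cases fs)
    case (Cons x xs)
    with that have x: "x \<in> carrier G" "irreducible G x" and xs: "set xs \<subseteq> carrier G"
      and u: "x \<otimes> foldr (\<otimes>) xs \<one> \<in> Units G"
      by (auto simp: factorizations_def factors_def)
    have "foldr (\<otimes>) xs \<one> \<in> carrier G" using xs by (induction xs) auto
    then have "x \<in> Units G" using u x unit_factor by blast
    then show ?thesis using x by (auto simp: irreducible_def)
  qed
  show ?R
  proof (intro conjI ballI)
    show "atomic G"
      using factors_exist by (fastforce simp: atomic_def factorizations_def)
  next
    fix a fs gs
    assume a: "a \<in> carrier G" and fs: "fs \<in> factorizations G a" and gs: "gs \<in> factorizations G a"
    show "essentially_equal G fs gs"
    proof (cases "a \<in> Units G")
      case True
      then show ?thesis using unit[OF True fs] unit[OF True gs] by simp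
    next
      case False
      then show ?thesis
        using a fs gs factors_unique[of fs a gs] by (simp add: factorizations_def)
    qed
  qed
next
  assume R: ?R
  show ?L
  proof
    fix a assume "a \<in> carrier G" "a \<notin> Units G"
    then have "factorizations G a \<noteq> {}" using R by (simp add: atomic_def)
    then show "\<exists>fs. set fs \<subseteq> carrier G \<and> factors G fs a" by (auto simp: factorizations_def)
  next
    fix fs a fs'
    assume "factors G fs a" "factors G fs' a" "a \<in> carrier G"
      "set fs \<subseteq> carrier G" "set fs' \<subseteq> carrier G"
    then have "fs \<in> factorizations G a" "fs' \<in> factorizations G a"
      by (simp_all add: factorizations_def)
    then show "essentially_equal G fs fs'" using R \<open>a \<in> carrier G\<close> by blast
  qed
qed


section \<open>The quotient group\<close>

text \<open>
  The elements of \<open>q(H)\<close> are the classes of formal fractions \<open>a / b\<close> with \<open>a, b \<in> H\<close>.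
\<close>

definition frac_rel :: "('a, 'b) monoid_scheme \<Rightarrow> (('a \<times> 'a) \<times> ('a \<times> 'a)) set" where
  "frac_rel H = {((a, b), (c, d)). a \<in> carrier H \<and> b \<in> carrier H \<and> c \<in> carrier H \<and> d \<in> carrier H
     \<and> a \<otimes>\<^bsub>H\<^esub> d = c \<otimes>\<^bsub>H\<^esub> b}"

definition frac :: "('a, 'b) monoid_scheme \<Rightarrow> 'a \<Rightarrow> 'a \<Rightarrow> ('a \<times> 'a) set" where
  "frac H a b = frac_rel H `` {(a, b)}"

definition quot_group :: "('a, 'b) monoid_scheme \<Rightarrow> ('a \<times> 'a) set monoid" where
  "quot_group H =
    \<lparr>carrier = (carrier H \<times> carrier H) // frac_rel H,
     mult = (\<lambda>x y. \<Union>(a, b)\<in>x. \<Union>(c, d)\<in>y. frac H (a \<otimes>\<^bsub>H\<^esub> c) (b \<otimes>\<^bsub>H\<^esub> d)),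
     one = frac H \<one>\<^bsub>H\<^esub> \<one>\<^bsub>H\<^esub>\<rparr>"

definition emb :: "('a, 'b) monoid_scheme \<Rightarrow> 'a \<Rightarrow> ('a \<times> 'a) set" where
  "emb H a = frac H a \<one>\<^bsub>H\<^esub>"

context comm_monoid_cancel
begin

lemma equiv_frac_rel: "equiv (carrier G \<times> carrier G) (frac_rel G)"
proof (rule equivI)
  show "frac_rel G \<subseteq> (carrier G \<times> carrier G) \<times> (carrier G \<times> carrier G)"
    by (auto simp: frac_rel_def)
  show "refl_on (carrier G \<times> carrier G) (frac_rel G)"
    by (auto simp: refl_on_def frac_rel_def)
  show "sym (frac_rel G)"
    by (auto simp: sym_def frac_rel_def)
  show "trans (frac_rel G)"
  proof (rule transI)
    fix x y z
    assume xy: "(x, y) \<in> frac_rel G" and yz: "(y, z) \<in> frac_rel G"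
    obtain a b c d e f where [simp]: "x = (a, b)" "y = (c, d)" "z = (e, f)"
      by (metis surj_pair)
    have cl: "a \<in> carrier G" "b \<in> carrier G" "c \<in> carrier G" "d \<in> carrier G"
        "e \<in> carrier G" "f \<in> carrier G"
      and e1: "a \<otimes> d = c \<otimes> b" and e2: "c \<otimes> f = e \<otimes> d"
      using xy yz by (auto simp: frac_rel_def)
    have "d \<otimes> (a \<otimes> f) = (a \<otimes> d) \<otimes> f" using cl by (simp add: m_ac)
    also have "\<dots> = (c \<otimes> f) \<otimes> b" using cl e1 by (simp add: m_ac)
    also have "\<dots> = d \<otimes> (e \<otimes> b)" using cl e2 by (simp add: m_ac)
    finally have "a \<otimes> f = e \<otimes> b" using cl l_cancel by blast
    then show "(x, z) \<in> frac_rel G" using cl by (simp add: frac_rel_def)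
  qed
qed

lemma frac_eq_iff:
  assumes "a \<in> carrier G" "b \<in> carrier G" "c \<in> carrier G" "d \<in> carrier G"
  shows "frac G a b = frac G c d \<longleftrightarrow> a \<otimes> d = c \<otimes> b"
  unfolding frac_def using assms eq_equiv_class_iff[OF equiv_frac_rel, of "(a, b)" "(c, d)"]
  by (simp add: frac_rel_def)

lemma carrier_quot_group:
  "carrier (quot_group G) = {frac G a b | a b. a \<in> carrier G \<and> b \<in> carrier G}"
  by (auto simp: quot_group_def quotient_def frac_def)

lemma frac_mult:
  assumes "a \<in> carrier G" "b \<in> carrier G" "c \<in> carrier G" "d \<in> carrier G"
  shows "frac G a b \<otimes>\<^bsub>quot_group G\<^esub> frac G c d = frac G (a \<otimes> c) (b \<otimes> d)"
proof -
  have eq: "frac G (a' \<otimes> c') (b' \<otimes> d') = frac G (a \<otimes> c) (b \<otimes> d)"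
    if "(a', b') \<in> frac G a b" "(c', d') \<in> frac G c d" for a' b' c' d'
  proof -
    from that have cl: "a' \<in> carrier G" "b' \<in> carrier G" "c' \<in> carrier G" "d' \<in> carrier G"
      and e1: "a \<otimes> b' = a' \<otimes> b" and e2: "c \<otimes> d' = c' \<otimes> d"
      by (auto simp: frac_def frac_rel_def)
    have "(a' \<otimes> c') \<otimes> (b \<otimes> d) = (a' \<otimes> b) \<otimes> (c' \<otimes> d)" using cl assms by (simp add: m_ac)
    also have "\<dots> = (a \<otimes> b') \<otimes> (c \<otimes> d')" by (simp add: e1 e2)
    also have "\<dots> = (a \<otimes> c) \<otimes> (b' \<otimes> d')" using cl assms by (simp add: m_ac)
    finally show ?thesis using cl assms by (simp add: frac_eq_iff)
  qed
  have mem: "(a, b) \<in> frac G a b" "(c, d) \<in> frac G c d"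
    using assms by (auto simp: frac_def frac_rel_def)
  have "(\<Union>(a', b')\<in>frac G a b. \<Union>(c', d')\<in>frac G c d. frac G (a' \<otimes> c') (b' \<otimes> d'))
      = (\<Union>p\<in>frac G a b. \<Union>q\<in>frac G c d. frac G (a \<otimes> c) (b \<otimes> d))"
    by (intro SUP_cong refl) (auto simp: eq)
  also have "\<dots> = frac G (a \<otimes> c) (b \<otimes> d)" using mem by auto
  finally show ?thesis by (simp add: quot_group_def)
qed

lemma frac_one: "\<one>\<^bsub>quot_group G\<^esub> = frac G \<one> \<one>"
  by (simp add: quot_group_def)

lemma frac_closed:
  "\<lbrakk>a \<in> carrier G; b \<in> carrier G\<rbrakk> \<Longrightarrow> frac G a b \<in> carrier (quot_group G)"
  by (auto simp: carrier_quot_group)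

lemma quot_group_cases:
  assumes "x \<in> carrier (quot_group G)"
  obtains a b where "x = frac G a b" "a \<in> carrier G" "b \<in> carrier G"
  using assms by (auto simp: carrier_quot_group)

lemma comm_group_quot_group: "comm_group (quot_group G)"
proof (rule comm_groupI)
  show "\<one>\<^bsub>quot_group G\<^esub> \<in> carrier (quot_group G)"
    by (simp add: frac_one frac_closed)
next
  fix x assume "x \<in> carrier (quot_group G)"
  then obtain a b where x: "x = frac G a b" "a \<in> carrier G" "b \<in> carrier G"
    by (rule quot_group_cases)
  then show "\<one>\<^bsub>quot_group G\<^esub> \<otimes>\<^bsub>quot_group G\<^esub> x = x"
    by (simp add: frac_one frac_mult)
  have "frac G b a \<otimes>\<^bsub>quot_group G\<^esub> x = \<one>\<^bsub>quot_group G\<^esub>"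
    using x by (simp add: frac_one frac_mult frac_eq_iff m_comm)
  then show "\<exists>y\<in>carrier (quot_group G). y \<otimes>\<^bsub>quot_group G\<^esub> x = \<one>\<^bsub>quot_group G\<^esub>"
    using x frac_closed by blast
next
  fix x y assume x: "x \<in> carrier (quot_group G)" and y: "y \<in> carrier (quot_group G)"
  from x obtain a b where "x = frac G a b" "a \<in> carrier G" "b \<in> carrier G"
    by (rule quot_group_cases)
  moreover from y obtain c d where "y = frac G c d" "c \<in> carrier G" "d \<in> carrier G"
    by (rule quot_group_cases)
  ultimately show "x \<otimes>\<^bsub>quot_group G\<^esub> y \<in> carrier (quot_group G)"
    and "x \<otimes>\<^bsub>quot_group G\<^esub> y = y \<otimes>\<^bsub>quot_group G\<^esub> x"
    by (simp_all add: frac_closed frac_mult m_comm)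
next
  fix x y z
  assume x: "x \<in> carrier (quot_group G)" and y: "y \<in> carrier (quot_group G)"
    and z: "z \<in> carrier (quot_group G)"
  from x obtain a b where "x = frac G a b" "a \<in> carrier G" "b \<in> carrier G"
    by (rule quot_group_cases)
  moreover from y obtain c d where "y = frac G c d" "c \<in> carrier G" "d \<in> carrier G"
    by (rule quot_group_cases)
  moreover from z obtain e f where "z = frac G e f" "e \<in> carrier G" "f \<in> carrier G"
    by (rule quot_group_cases)
  ultimately show "(x \<otimes>\<^bsub>quot_group G\<^esub> y) \<otimes>\<^bsub>quot_group G\<^esub> z =
      x \<otimes>\<^bsub>quot_group G\<^esub> (y \<otimes>\<^bsub>quot_group G\<^esub> z)"
    by (simp add: frac_mult m_assoc)
qed

lemma emb_hom: "emb G \<in> hom G (quot_group G)"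
  by (simp add: hom_def emb_def frac_closed frac_mult Pi_def)

lemma inj_on_emb: "inj_on (emb G) (carrier G)"
  by (auto simp: inj_on_def emb_def frac_eq_iff)

lemma frac_eq_quotient:
  assumes "a \<in> carrier G" "b \<in> carrier G"
  shows "frac G a b = emb G a \<otimes>\<^bsub>quot_group G\<^esub> inv\<^bsub>quot_group G\<^esub> (emb G b)"
proof -
  interpret Q: comm_group "quot_group G" by (rule comm_group_quot_group)
  have "frac G a b \<otimes>\<^bsub>quot_group G\<^esub> emb G b = emb G a"
    using assms by (simp add: emb_def frac_mult frac_eq_iff m_ac)
  then have "emb G a \<otimes>\<^bsub>quot_group G\<^esub> inv\<^bsub>quot_group G\<^esub> (emb G b) =
      frac G a b \<otimes>\<^bsub>quot_group G\<^esub> emb G b \<otimes>\<^bsub>quot_group G\<^esub> inv\<^bsub>quot_group G\<^esub> (emb G b)"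
    by (rule arg_cong[OF sym])
  also have "\<dots> = frac G a b"
    using assms by (simp add: Q.m_assoc emb_def frac_closed)
  finally show ?thesis ..
qed

end


section \<open>v-ideals, v-Noetherian monoids and Krull monoids\<close>

text \<open>
  \<open>H\<close> is identified with its image \<open>emb H ` carrier H\<close> in \<open>quot_group H\<close>; in particular
  v-ideals are sets of elements of \<open>quot_group H\<close>. They are not required to be nonempty.
\<close>

definition colon :: "('a, 'b) monoid_scheme \<Rightarrow> ('a \<times> 'a) set set \<Rightarrow> ('a \<times> 'a) set set" where
  "colon H X = {z \<in> carrier (quot_group H).
     \<forall>x\<in>X. z \<otimes>\<^bsub>quot_group H\<^esub> x \<in> emb H ` carrier H}"

definition v_closure :: "('a, 'b) monoid_scheme \<Rightarrow> ('a \<times> 'a) set set \<Rightarrow> ('a \<times> 'a) set set" where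
  "v_closure H X = colon H (colon H X)"

definition v_ideal :: "('a, 'b) monoid_scheme \<Rightarrow> ('a \<times> 'a) set set \<Rightarrow> bool" where
  "v_ideal H X \<longleftrightarrow> X \<subseteq> emb H ` carrier H \<and> v_closure H X = X"

definition v_noetherian :: "('a, 'b) monoid_scheme \<Rightarrow> bool" where
  "v_noetherian H \<longleftrightarrow>
    (\<forall>X :: nat \<Rightarrow> ('a \<times> 'a) set set.
       (\<forall>n. v_ideal H (X n)) \<and> (\<forall>n. X n \<subseteq> X (Suc n)) \<longrightarrow> (\<exists>n. \<forall>m\<ge>n. X m = X n))"

definition completely_integrally_closed :: "('a, 'b) monoid_scheme \<Rightarrow> bool" where
  "completely_integrally_closed H \<longleftrightarrow>
    (\<forall>x\<in>carrier (quot_group H).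
       (\<exists>c\<in>carrier H. \<forall>n::nat.
          emb H c \<otimes>\<^bsub>quot_group H\<^esub> (x [^]\<^bsub>quot_group H\<^esub> n) \<in> emb H ` carrier H)
       \<longrightarrow> x \<in> emb H ` carrier H)"

definition krull :: "('a, 'b) monoid_scheme \<Rightarrow> bool" where
  "krull H \<longleftrightarrow> v_noetherian H \<and> completely_integrally_closed H"

end

theory Submission
  imports Defs "HOL-Library.Countable" "HOL-Library.Infinite_Set"
begin

text \<open>
  The monoid \<open>N = (\<nat>, +)\<close> has all seven properties. Its ultrapower satisfies the same sentences and
  contains the class \<open>x\<^sub>k\<close> of \<open>i \<mapsto> i - k\<close> for every \<open>k\<close>, where \<open>x\<^sub>k = p x\<^sub>k\<^sub>+\<^sub>1\<close> for the class \<open>p\<close> of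
  the constant 1. Every non-unit of the ultrapower is divisible by \<open>p\<close>, so \<open>p\<close> is the only atom up to
  associates and \<open>x\<^sub>0\<close> has no factorization; and the principal ideals of the \<open>x\<^sub>k\<close> ascend strictly, so the
  monoid is not v-Noetherian. As the ultrapower is uncountable while \<open>'a\<close> may be countable, it is
  replaced by the countable Skolem hull of the \<open>x\<^sub>k\<close> and \<open>p\<close>, which still obeys the theorem of Los.
\<close>

section \<open>Ultrafilters below a given filter\<close>

text \<open>Zorn's lemma yields a minimal proper filter below \<open>F\<close>. The infimum of a
  nonempty chain stays proper, since whatever holds eventually for it already does so for some
  member. A minimal \<open>U\<close> decides every \<open>P\<close>: restricting it to the set where
  \<open>P\<close> holds either gives \<open>bot\<close>, so that \<open>P\<close> fails eventually,
  or leaves \<open>U\<close> unchanged.\<close>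

lemma ex_ultrafilter_le:
  fixes F :: "'a filter"
  assumes "F \<noteq> bot"
  obtains U where "U \<noteq> bot" "U \<le> F" "\<And>P. eventually P U \<or> eventually (\<lambda>x. \<not> P x) U"
proof -
  define A where "A = {G. G \<noteq> bot \<and> G \<le> F}"
  have "\<exists>U\<in>A. \<forall>G\<in>A. G \<le> U \<longrightarrow> G = U"
  proof (rule predicate_Zorn)
    show "partial_order_on A (relation_of (\<lambda>G H. H \<le> G) A)"
      by (intro partial_order_on_relation_ofI) auto
  next
    fix C assume C: "C \<in> Chains (relation_of (\<lambda>G H. H \<le> G) A)"
    then have CA: "C \<subseteq> A" and chain: "\<And>G H. G \<in> C \<Longrightarrow> H \<in> C \<Longrightarrow> G \<le> H \<or> H \<le> G"
      by (auto simp: Chains_def relation_of_def)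
    show "\<exists>L\<in>A. \<forall>G\<in>C. L \<le> G"
    proof (cases "C = {}")
      case True
      then show ?thesis using assms by (auto simp: A_def)
    next
      case False
      have "eventually P (Inf C) \<longleftrightarrow> (\<exists>G\<in>C. eventually P G)" for P
        using False chain by (intro eventually_Inf_base) (auto intro: inf_absorb1 inf_absorb2)
      then have "Inf C \<noteq> bot"
        using CA by (auto simp: trivial_limit_def A_def)
      moreover have "Inf C \<le> F"
        using False CA by (auto simp: A_def intro: Inf_lower2)
      ultimately show ?thesis by (auto simp: A_def intro: Inf_lower)
    qed
  qed
  then obtain U where U: "U \<noteq> bot" "U \<le> F" and min: "\<And>G. G \<noteq> bot \<Longrightarrow> G \<le> U \<Longrightarrow> G = U"
    by (auto simp: A_def)
  have "eventually P U \<or> eventually (\<lambda>x. \<not> P x) U" for P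
  proof (cases "inf U (principal {x. P x}) = bot")
    case True
    then show ?thesis by (simp add: trivial_limit_def eventually_inf_principal)
  next
    case False
    then have "inf U (principal {x. P x}) = U" by (intro min) auto
    then have "U \<le> principal {x. P x}" by (simp add: inf.absorb_iff1)
    then show ?thesis by (simp add: le_principal)
  qed
  with U show ?thesis by (rule that)
qed

section \<open>Skolem terms and their values\<close>

instance mon_term :: countable by countable_datatype
instance mon_form :: countable by countable_datatype

text \<open>
  Names for the elements of the Skolem hull of a sequence \<open>v\<close>: \<open>Base k\<close> denotes \<open>v k\<close>, and
  \<open>Witness m \<phi> ts\<close> denotes a value of the variable \<open>m\<close> satisfying \<open>\<phi>\<close> when the \<open>k\<close>-th variable
  has the value of the \<open>k\<close>-th entry of \<open>ts\<close>.
\<close>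

datatype hull_term =
    Base nat
  | Unit
  | Prod hull_term hull_term
  | Witness nat mon_form "hull_term list"

instance hull_term :: countable by countable_datatype


text \<open>A Skolem function made total: the valuation is one beyond the end of the list, and so is
  the result when no solution exists. Arguments come as finite lists so that there are only
  countably many Skolem terms.\<close>

definition witness :: "('a, 'b) monoid_scheme \<Rightarrow> nat \<Rightarrow> mon_form \<Rightarrow> 'a list \<Rightarrow> 'a" where
  "witness H m \<phi> xs = (let v = (\<lambda>k. if k < length xs then xs ! k else \<one>\<^bsub>H\<^esub>) in
     if \<exists>x\<in>carrier H. holds H (v(m := x)) \<phi> then SOME x. x \<in> carrier H \<and> holds H (v(m := x)) \<phi>
     else \<one>\<^bsub>H\<^esub>)"

primrec hull_val :: "('a, 'b) monoid_scheme \<Rightarrow> (nat \<Rightarrow> 'a) \<Rightarrow> hull_term \<Rightarrow> 'a" where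
  "hull_val H v (Base k) = v k"
| "hull_val H v Unit = \<one>\<^bsub>H\<^esub>"
| "hull_val H v (Prod s t) = hull_val H v s \<otimes>\<^bsub>H\<^esub> hull_val H v t"
| "hull_val H v (Witness m \<phi> ts) = witness H m \<phi> (map (hull_val H v) ts)"

lemma witness_closed:
  assumes "\<one>\<^bsub>H\<^esub> \<in> carrier H"
  shows "witness H m \<phi> xs \<in> carrier H"
proof -
  define v where "v = (\<lambda>k. if k < length xs then xs ! k else \<one>\<^bsub>H\<^esub>)"
  have "(SOME x. x \<in> carrier H \<and> holds H (v(m := x)) \<phi>) \<in> carrier H"
    if "\<exists>x\<in>carrier H. holds H (v(m := x)) \<phi>"
    using that by (rule someI2_bex) simp
  then show ?thesis using assms by (auto simp: witness_def Let_def simp flip: v_def)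
qed

lemma (in monoid) hull_val_closed:
  assumes "range v \<subseteq> carrier G"
  shows "hull_val G v t \<in> carrier G"
  using assms by (induction t) (auto simp: witness_closed)

lemma finite_term_vars: "finite (term_vars t)"
  by (induction t) auto

lemma finite_free_vars: "finite (free_vars \<phi>)"
  by (induction \<phi>) (auto simp: finite_term_vars)

text \<open>The truth of \<open>\<phi>\<close> depends only on variables below \<open>N\<close>, so
  the list of their values carries all the information that the witness needs, and the default
  values further out do no harm.\<close>

lemma holds_witness:
  assumes bound: "free_vars \<phi> \<subseteq> {..<N}" and ex: "\<exists>x\<in>carrier H. holds H (v(m := x)) \<phi>"
  shows "holds H (v(m := witness H m \<phi> (map v [0..<N]))) \<phi>"
proof -
  define w where
    "w = (\<lambda>k. if k < length (map v [0..<N]) then map v [0..<N] ! k else \<one>\<^bsub>H\<^esub>)"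
  have "w k = v k" if "k < N" for k using that by (simp add: w_def)
  then have eq: "holds H (w(m := x)) \<phi> \<longleftrightarrow> holds H (v(m := x)) \<phi>" for x
    using bound by (intro holds_cong) auto
  have "witness H m \<phi> (map v [0..<N]) = (SOME x. x \<in> carrier H \<and> holds H (w(m := x)) \<phi>)"
    using ex unfolding witness_def w_def[symmetric] Let_def eq by simp
  moreover have "holds H (v(m := (SOME x. x \<in> carrier H \<and> holds H (w(m := x)) \<phi>))) \<phi>"
    using someI_ex[of "\<lambda>x. x \<in> carrier H \<and> holds H (w(m := x)) \<phi>"] ex unfolding eq by blast
  ultimately show ?thesis by simp
qed

section \<open>The hull inside the ultrapower and the theorem of Los\<close>

locale ultrapower_hull = comm_monoid_cancel G for G :: "'a monoid" (structure) +
  fixes b :: "nat \<Rightarrow> 'i \<Rightarrow> 'a" and U :: "'i filter" and enc :: "hull_term \<Rightarrow> 'a"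
  assumes b_closed: "b k i \<in> carrier G"
    and U_proper: "U \<noteq> bot"
    and ultra: "eventually P U \<or> eventually (\<lambda>i. \<not> P i) U"
    and inj_enc: "inj enc"
begin

abbreviation val :: "'i \<Rightarrow> hull_term \<Rightarrow> 'a" where
  "val i \<equiv> hull_val G (\<lambda>k. b k i)"

text \<open>A class of terms modulo agreement \<open>U\<close>-almost everywhere is represented by
  one chosen term; the choice depends on the class only. The injection \<open>enc\<close> moves it
  into the type of \<open>G\<close>, so that the hull lives on the same type.\<close>

definition elt :: "hull_term \<Rightarrow> 'a" where
  "elt t = enc (SOME s. \<forall>\<^sub>F i in U. val i s = val i t)"

definition hull :: "'a monoid" where
  "hull = \<lparr>carrier = range elt, mult = (\<lambda>x y. elt (Prod (inv_into UNIV elt x) (inv_into UNIV elt y))),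
     one = elt Unit\<rparr>"

text \<open>The negation case of the theorem of Los: properness excludes that both \<open>P\<close>
  and its negation are large, and \<open>ultra\<close> excludes that neither is.\<close>

lemma eventually_not_iff: "eventually (\<lambda>i. \<not> P i) U \<longleftrightarrow> \<not> eventually P U"
proof
  assume "eventually (\<lambda>i. \<not> P i) U"
  then show "\<not> eventually P U"
    using U_proper eventually_conj[of "\<lambda>i. \<not> P i" U P] by (auto simp: trivial_limit_def)
qed (use ultra in blast)

lemma val_closed: "val i t \<in> carrier G"
  by (rule hull_val_closed) (auto simp: b_closed)

lemma elt_eq_iff: "elt s = elt t \<longleftrightarrow> (\<forall>\<^sub>F i in U. val i s = val i t)"
proof
  have rep: "\<forall>\<^sub>F i in U. val i (SOME s. \<forall>\<^sub>F i in U. val i s = val i t) = val i t" for t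
    by (rule someI[of "\<lambda>s. \<forall>\<^sub>F i in U. val i s = val i t" t]) simp
  assume "elt s = elt t"
  then have "(SOME u. \<forall>\<^sub>F i in U. val i u = val i s) = (SOME u. \<forall>\<^sub>F i in U. val i u = val i t)"
    using inj_enc by (simp add: elt_def inj_eq)
  then show "\<forall>\<^sub>F i in U. val i s = val i t"
    using eventually_conj[OF rep[of s] rep[of t]] by (auto elim: eventually_mono)
next
  assume "\<forall>\<^sub>F i in U. val i s = val i t"
  then have "(\<forall>\<^sub>F i in U. val i u = val i s) \<longleftrightarrow> (\<forall>\<^sub>F i in U. val i u = val i t)" for u
    by (auto elim: eventually_elim2)
  then show "elt s = elt t" by (simp add: elt_def)
qed

lemma carrier_hull: "carrier hull = range elt"
  by (simp add: hull_def)

lemma one_hull: "\<one>\<^bsub>hull\<^esub> = elt Unit"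
  by (simp add: hull_def)

text \<open>The product in \<open>hull\<close> is computed from arbitrary preimages. These agree
  eventually with the given terms, hence so do their products.\<close>

lemma mult_hull: "elt s \<otimes>\<^bsub>hull\<^esub> elt t = elt (Prod s t)"
proof -
  have "\<forall>\<^sub>F i in U. val i (inv_into UNIV elt (elt t)) = val i t" for t
    by (simp add: f_inv_into_f flip: elt_eq_iff)
  from eventually_conj[OF this[of s] this[of t]]
  have "elt (Prod (inv_into UNIV elt (elt s)) (inv_into UNIV elt (elt t))) = elt (Prod s t)"
    by (auto simp: elt_eq_iff elim: eventually_mono)
  then show ?thesis by (simp add: hull_def)
qed

lemma comm_monoid_cancel_hull: "comm_monoid_cancel hull"
proof (rule comm_monoid_cancelI)
  show "comm_monoid hull"
  proof (rule comm_monoidI)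
    fix x y z
    assume "x \<in> carrier hull" "y \<in> carrier hull" "z \<in> carrier hull"
    then show "x \<otimes>\<^bsub>hull\<^esub> y \<otimes>\<^bsub>hull\<^esub> z = x \<otimes>\<^bsub>hull\<^esub> (y \<otimes>\<^bsub>hull\<^esub> z)"
      by (auto simp: carrier_hull mult_hull elt_eq_iff m_assoc val_closed)
  qed (auto simp: carrier_hull mult_hull one_hull elt_eq_iff val_closed m_comm intro: rangeI)
next
  fix x y z
  assume "x \<otimes>\<^bsub>hull\<^esub> z = y \<otimes>\<^bsub>hull\<^esub> z" "x \<in> carrier hull" "y \<in> carrier hull" "z \<in> carrier hull"
  then show "x = y"
    by (auto simp: carrier_hull mult_hull elt_eq_iff elim!: eventually_mono
        dest: r_cancel[OF _ val_closed val_closed val_closed])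
qed

text \<open>Substituting \<open>\<sigma> k\<close> for the \<open>k\<close>-th variable turns
  \<open>t\<close> into a hull term \<open>u\<close>, which serves for all indices \<open>i\<close>
  at once.\<close>

lemma term_val_hull:
  obtains u where "term_val hull (\<lambda>k. elt (\<sigma> k)) t = elt u"
    "\<And>i. term_val G (\<lambda>k. val i (\<sigma> k)) t = val i u"
proof -
  have "\<exists>u. term_val hull (\<lambda>k. elt (\<sigma> k)) t = elt u \<and> (\<forall>i. term_val G (\<lambda>k. val i (\<sigma> k)) t = val i u)"
  proof (induction t)
    case (Var k)
    show ?case by (auto intro!: exI[of _ "\<sigma> k"])
  next
    case One
    show ?case by (auto intro!: exI[of _ Unit] simp: one_hull)
  next
    case (Mult t1 t2)
    then obtain u1 u2 where
      "term_val hull (\<lambda>k. elt (\<sigma> k)) t1 = elt u1" "\<forall>i. term_val G (\<lambda>k. val i (\<sigma> k)) t1 = val i u1"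
      "term_val hull (\<lambda>k. elt (\<sigma> k)) t2 = elt u2" "\<forall>i. term_val G (\<lambda>k. val i (\<sigma> k)) t2 = val i u2"
      by blast
    then show ?case by (auto intro!: exI[of _ "Prod u1 u2"] simp: mult_hull)
  qed
  then show thesis using that by blast
qed

text \<open>Induction on the formula, as for a full ultrapower. In the quantifier case the
  counterexamples at the various indices must form an element of the hull; closure under Skolem
  functions guarantees this.\<close>

theorem los_hull:
  "holds hull (\<lambda>k. elt (\<sigma> k)) \<phi> \<longleftrightarrow> (\<forall>\<^sub>F i in U. holds G (\<lambda>k. val i (\<sigma> k)) \<phi>)"
proof (induction \<phi> arbitrary: \<sigma>)
  case (Eq s t)
  obtain u where "term_val hull (\<lambda>k. elt (\<sigma> k)) s = elt u"
    "\<And>i. term_val G (\<lambda>k. val i (\<sigma> k)) s = val i u" by (rule term_val_hull[of \<sigma> s]) (rule that)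
  moreover obtain w where "term_val hull (\<lambda>k. elt (\<sigma> k)) t = elt w"
    "\<And>i. term_val G (\<lambda>k. val i (\<sigma> k)) t = val i w" by (rule term_val_hull[of \<sigma> t]) (rule that)
  ultimately show ?case by (simp add: elt_eq_iff)
next
  case (Neg \<phi>)
  then show ?case by (simp add: eventually_not_iff)
next
  case (Conj \<phi> \<psi>)
  then show ?case by (simp add: eventually_conj_iff)
next
  case (Forall m \<phi>)
  have IH: "holds hull ((\<lambda>k. elt (\<sigma> k))(m := elt t)) \<phi> \<longleftrightarrow>
      (\<forall>\<^sub>F i in U. holds G ((\<lambda>k. val i (\<sigma> k))(m := val i t)) \<phi>)" for t
  proof -
    have upd: "(\<lambda>k. f ((\<sigma>(m := t)) k)) = (\<lambda>k. f (\<sigma> k))(m := f t)" for f :: "hull_term \<Rightarrow> 'a"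
      by auto
    show ?thesis using Forall.IH[of "\<sigma>(m := t)"] unfolding upd .
  qed
  have "holds hull (\<lambda>k. elt (\<sigma> k)) (Forall m \<phi>) \<longleftrightarrow>
      (\<forall>t. \<forall>\<^sub>F i in U. holds G ((\<lambda>k. val i (\<sigma> k))(m := val i t)) \<phi>)"
    by (simp add: carrier_hull IH)
  also have "\<dots> \<longleftrightarrow> (\<forall>\<^sub>F i in U. \<forall>x\<in>carrier G. holds G ((\<lambda>k. val i (\<sigma> k))(m := x)) \<phi>)"
  proof
    assume all: "\<forall>t. \<forall>\<^sub>F i in U. holds G ((\<lambda>k. val i (\<sigma> k))(m := val i t)) \<phi>"
    obtain N where N: "free_vars (Neg \<phi>) \<subseteq> {..<N}"
      using finite_nat_bounded[OF finite_free_vars] by blast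
    \<comment> \<open>A single term that denotes, at every index where the universal claim fails, a
      value violating \<open>\<phi>\<close>. If \<open>\<phi>\<close> holds at this value, the
      universal claim holds at that index.\<close>
    define t where "t = Witness m (Neg \<phi>) (map \<sigma> [0..<N])"
    have t: "val i t = witness G m (Neg \<phi>) (map (\<lambda>k. val i (\<sigma> k)) [0..<N])" for i
      by (simp add: t_def comp_def)
    show "\<forall>\<^sub>F i in U. \<forall>x\<in>carrier G. holds G ((\<lambda>k. val i (\<sigma> k))(m := x)) \<phi>"
      using all[rule_format, of t]
    proof (rule eventually_mono)
      fix i assume "holds G ((\<lambda>k. val i (\<sigma> k))(m := val i t)) \<phi>"
      then show "\<forall>x\<in>carrier G. holds G ((\<lambda>k. val i (\<sigma> k))(m := x)) \<phi>"
        using holds_witness[OF N, of G "\<lambda>k. val i (\<sigma> k)" m] by (auto simp: t)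
    qed
  qed (auto simp: val_closed elim: eventually_mono)
  finally show ?case by simp
qed

end

text \<open>The countably many hull terms inject into any infinite type. The sequence
  \<open>c\<close> consists of the classes of the \<open>b k\<close>, so formulas with these as
  parameters transfer as well as sentences.\<close>

lemma elementary_hull_exists:
  fixes G :: "'a monoid" and b :: "nat \<Rightarrow> 'i \<Rightarrow> 'a"
  assumes "infinite (UNIV :: 'a set)" "comm_monoid_cancel G" "\<And>k i. b k i \<in> carrier G"
    and "U \<noteq> bot" "\<And>P. eventually P U \<or> eventually (\<lambda>i. \<not> P i) U"
  obtains K :: "'a monoid" and c where "comm_monoid_cancel K" "range c \<subseteq> carrier K"
    "\<And>\<phi>. holds K c \<phi> \<longleftrightarrow> (\<forall>\<^sub>F i in U. holds G (\<lambda>k. b k i) \<phi>)"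
proof -
  obtain f :: "nat \<Rightarrow> 'a" where "inj f"
    using infinite_countable_subset[OF assms(1)] by blast
  then have "inj (f \<circ> (to_nat :: hull_term \<Rightarrow> nat))" by (simp add: inj_compose)
  then interpret ultrapower_hull G b U "f \<circ> to_nat"
    using assms unfolding ultrapower_hull_def ultrapower_hull_axioms_def by blast
  show thesis
  proof (rule that)
    show "range (\<lambda>k. elt (Base k)) \<subseteq> carrier hull" by (auto simp: carrier_hull)
    show "holds hull (\<lambda>k. elt (Base k)) \<phi> \<longleftrightarrow> (\<forall>\<^sub>F i in U. holds G (\<lambda>k. b k i) \<phi>)" for \<phi>
      by (simp add: los_hull)
  qed (rule comm_monoid_cancel_hull)
qed

section \<open>Principal v-ideals and infinite descending divisor chains\<close>

context comm_monoid_cancel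
begin

lemma colon_mult_closed:
  assumes "X \<subseteq> carrier (quot_group G)" "z \<in> colon G X" "h \<in> carrier G"
  shows "z \<otimes>\<^bsub>quot_group G\<^esub> emb G h \<in> colon G X"
proof -
  interpret Q: comm_group "quot_group G" by (rule comm_group_quot_group)
  have h: "emb G h \<in> carrier (quot_group G)" using assms by (simp add: emb_def frac_closed)
  have zQ: "z \<in> carrier (quot_group G)" using assms(2) by (simp add: colon_def)
  have "(z \<otimes>\<^bsub>quot_group G\<^esub> emb G h) \<otimes>\<^bsub>quot_group G\<^esub> x \<in> emb G ` carrier G" if "x \<in> X" for x
  proof -
    have xQ: "x \<in> carrier (quot_group G)" using assms(1) that by blast
    have "z \<otimes>\<^bsub>quot_group G\<^esub> x \<in> emb G ` carrier G"
      using assms(2) that by (simp add: colon_def)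
    then obtain a where a: "a \<in> carrier G" "z \<otimes>\<^bsub>quot_group G\<^esub> x = emb G a"
      by blast
    have "(z \<otimes>\<^bsub>quot_group G\<^esub> emb G h) \<otimes>\<^bsub>quot_group G\<^esub> x
        = (z \<otimes>\<^bsub>quot_group G\<^esub> x) \<otimes>\<^bsub>quot_group G\<^esub> emb G h"
      using zQ h xQ by (simp only: Q.m_assoc Q.m_comm[of "emb G h" x])
    also have "\<dots> = emb G (a \<otimes> h)"
      using a assms hom_mult[OF emb_hom] by simp
    finally show ?thesis using a assms by simp
  qed
  then show ?thesis using assms h by (simp add: colon_def)
qed

text \<open>A v-ideal is itself a colon set, and colon sets absorb multiplication by elements of the
  monoid.\<close>

lemma v_ideal_mult_closed:
  assumes "v_ideal G X" "z \<in> X" "h \<in> carrier G"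
  shows "z \<otimes>\<^bsub>quot_group G\<^esub> emb G h \<in> X"
proof -
  have "colon G X \<subseteq> carrier (quot_group G)" by (auto simp: colon_def)
  moreover have "colon G (colon G X) = X" using assms by (simp add: v_ideal_def v_closure_def)
  ultimately show ?thesis using colon_mult_closed[of "colon G X" z h] assms by simp
qed

text \<open>Testing \<open>z\<close> on the generator \<open>y\<close> alone already puts
  \<open>z\<close> times \<open>y\<close> into the monoid. Used for \<open>y\<close> and then for
  its inverse, this shows that principal ideals are v-ideals.\<close>

lemma colon_principal:
  assumes y: "y \<in> carrier (quot_group G)"
  shows "colon G ((\<lambda>h. y \<otimes>\<^bsub>quot_group G\<^esub> emb G h) ` carrier G) =
    (\<lambda>h. inv\<^bsub>quot_group G\<^esub> y \<otimes>\<^bsub>quot_group G\<^esub> emb G h) ` carrier G"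
proof -
  interpret Q: comm_group "quot_group G" by (rule comm_group_quot_group)
  have emb: "emb G h \<in> carrier (quot_group G)" if "h \<in> carrier G" for h
    using that by (simp add: emb_def frac_closed)
  have emb_mult: "emb G a \<otimes>\<^bsub>quot_group G\<^esub> emb G h = emb G (a \<otimes> h)"
    if "a \<in> carrier G" "h \<in> carrier G" for a h
    using that hom_mult[OF emb_hom] by simp
  show ?thesis
  proof (intro subset_antisym subsetI)
    fix z assume z: "z \<in> colon G ((\<lambda>h. y \<otimes>\<^bsub>quot_group G\<^esub> emb G h) ` carrier G)"
    then have zQ: "z \<in> carrier (quot_group G)"
      and "z \<otimes>\<^bsub>quot_group G\<^esub> (y \<otimes>\<^bsub>quot_group G\<^esub> emb G \<one>) \<in> emb G ` carrier G"
      by (auto simp: colon_def)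
    then obtain h where h: "h \<in> carrier G" "z \<otimes>\<^bsub>quot_group G\<^esub> y = emb G h"
      using y by (auto simp: emb_def simp flip: frac_one)
    have "inv\<^bsub>quot_group G\<^esub> y \<otimes>\<^bsub>quot_group G\<^esub> emb G h = z"
      using y zQ by (simp flip: h(2) add: Q.m_comm[of z y] Q.inv_solve_left')
    then show "z \<in> (\<lambda>h. inv\<^bsub>quot_group G\<^esub> y \<otimes>\<^bsub>quot_group G\<^esub> emb G h) ` carrier G"
      using h by blast
  next
    fix z assume "z \<in> (\<lambda>h. inv\<^bsub>quot_group G\<^esub> y \<otimes>\<^bsub>quot_group G\<^esub> emb G h) ` carrier G"
    then obtain a where a: "a \<in> carrier G" "z = inv\<^bsub>quot_group G\<^esub> y \<otimes>\<^bsub>quot_group G\<^esub> emb G a"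
      by blast
    have "z \<otimes>\<^bsub>quot_group G\<^esub> (y \<otimes>\<^bsub>quot_group G\<^esub> emb G h) = emb G (a \<otimes> h)" if "h \<in> carrier G" for h
    proof -
      have "z \<otimes>\<^bsub>quot_group G\<^esub> (y \<otimes>\<^bsub>quot_group G\<^esub> emb G h)
          = (inv\<^bsub>quot_group G\<^esub> y \<otimes>\<^bsub>quot_group G\<^esub> y) \<otimes>\<^bsub>quot_group G\<^esub> (emb G a \<otimes>\<^bsub>quot_group G\<^esub> emb G h)"
        unfolding a(2) by (simp only: Q.m_ac Q.m_closed Q.inv_closed y emb a(1) that)
      then show ?thesis using y emb a that by (simp add: emb_mult)
    qed
    then show "z \<in> colon G ((\<lambda>h. y \<otimes>\<^bsub>quot_group G\<^esub> emb G h) ` carrier G)"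
      using y emb a by (auto simp: colon_def)
  qed
qed

lemma v_ideal_principal:
  assumes a: "a \<in> carrier G"
  shows "v_ideal G ((\<lambda>h. emb G (a \<otimes> h)) ` carrier G)"
proof -
  interpret Q: comm_group "quot_group G" by (rule comm_group_quot_group)
  have aQ: "emb G a \<in> carrier (quot_group G)" using a by (simp add: emb_def frac_closed)
  have "(\<lambda>h. emb G (a \<otimes> h)) ` carrier G = (\<lambda>h. emb G a \<otimes>\<^bsub>quot_group G\<^esub> emb G h) ` carrier G"
    using a hom_mult[OF emb_hom] by (intro image_cong) auto
  then have "v_closure G ((\<lambda>h. emb G (a \<otimes> h)) ` carrier G) = (\<lambda>h. emb G (a \<otimes> h)) ` carrier G"
    using aQ by (simp add: v_closure_def colon_principal)
  then show ?thesis using a by (auto simp: v_ideal_def)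
qed

text \<open>The principal ideals of the \<open>x k\<close> ascend. If two consecutive ones were
  equal, \<open>x (Suc n)\<close> would be a multiple of \<open>x n\<close>, hence equal to
  \<open>x (Suc n)\<close> times \<open>p\<close> times some \<open>h\<close>; by cancellation
  \<open>p\<close> would be a unit.\<close>

lemma not_v_noetherian_if_descending:
  assumes p: "p \<in> carrier G" "p \<notin> Units G"
    and x: "\<And>k. x k \<in> carrier G" "\<And>k. x k = p \<otimes> x (Suc k)"
  shows "\<not> v_noetherian G"
proof
  assume noeth: "v_noetherian G"
  define X where "X k = (\<lambda>h. emb G (x k \<otimes> h)) ` carrier G" for k
  have "X k \<subseteq> X (Suc k)" for k
  proof
    fix z assume "z \<in> X k"
    then obtain h where h: "h \<in> carrier G" "z = emb G (x k \<otimes> h)" by (auto simp: X_def)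
    then have "z = emb G (x (Suc k) \<otimes> (p \<otimes> h))"
      using p x(1)[of "Suc k"] by (simp add: x(2)[of k] m_ac)
    then show "z \<in> X (Suc k)" using p h by (auto simp: X_def)
  qed
  moreover have "v_ideal G (X k)" for k
    using v_ideal_principal[OF x(1)] by (simp add: X_def)
  ultimately have "\<exists>n. \<forall>m\<ge>n. X m = X n"
    using noeth[unfolded v_noetherian_def, THEN spec, of X] by simp
  then obtain n where n: "\<forall>m\<ge>n. X m = X n" ..
  have "X (Suc n) = X n" by (rule n[rule_format]) simp
  moreover have "emb G (x (Suc n) \<otimes> \<one>) \<in> X (Suc n)"
    unfolding X_def by (rule imageI) simp
  ultimately obtain h where h: "h \<in> carrier G" "emb G (x (Suc n) \<otimes> \<one>) = emb G (x n \<otimes> h)"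
    by (auto simp: X_def)
  then have "x (Suc n) \<otimes> \<one> = x n \<otimes> h"
    using x(1) by (intro inj_onD[OF inj_on_emb]) auto
  also have "\<dots> = x (Suc n) \<otimes> (p \<otimes> h)"
    using p h x(1)[of "Suc n"] by (simp add: x(2)[of n] m_ac)
  finally have "p \<otimes> h = \<one>"
    using l_cancel[of "x (Suc n)" \<one> "p \<otimes> h"] p h x(1)[of "Suc n"] by simp
  then show False using p h unit_factor[of p h] by simp
qed

text \<open>Every atom is divisible by \<open>p\<close> and hence equals \<open>p\<close>, so a
  factorization of \<open>x 0\<close> of length \<open>k\<close> makes \<open>x 0\<close> the
  \<open>k\<close>-th power of \<open>p\<close>. But \<open>x 0\<close> is also that power times
  \<open>x k\<close>, so cancellation gives \<open>x k\<close> the value one, which makes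
  \<open>p\<close> a unit.\<close>

lemma not_atomic_if_descending:
  assumes p: "p \<in> carrier G" "p \<noteq> \<one>"
    and reduced: "Units G = {\<one>}"
    and dvd: "\<And>a. a \<in> carrier G \<Longrightarrow> a \<noteq> \<one> \<Longrightarrow> p divides a"
    and x: "\<And>k. x k \<in> carrier G" "\<And>k. x k = p \<otimes> x (Suc k)"
  shows "\<not> atomic G"
proof
  assume "atomic G"
  have x_nonunit: "x k \<noteq> \<one>" for k
    using p x(1)[of "Suc k"] unit_factor[of p "x (Suc k)"] reduced by (auto simp flip: x(2)[of k])
  then have "x 0 \<in> carrier G - Units G" using x(1) reduced by simp
  then have "factorizations G (x 0) \<noteq> {}" using \<open>atomic G\<close> by (simp add: atomic_def)
  then obtain fs where fs: "set fs \<subseteq> carrier G" "factors G fs (x 0)"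
    by (auto simp: factorizations_def)
  have "f = p" if "f \<in> set fs" for f
  proof -
    have f: "f \<in> carrier G" "irreducible G f" using that fs by (auto simp: factors_def)
    then have "f \<noteq> \<one>" using reduced by (auto simp: irreducible_def)
    then obtain c where "c \<in> carrier G" "f = p \<otimes> c" using dvd f by (auto simp: factor_def)
    moreover from this have "c = \<one>" using f p reduced by (auto simp: irreducible_iff_atom)
    ultimately show ?thesis using p by simp
  qed
  then have rep: "replicate (length fs) p = fs" by (simp add: replicate_length_same)
  have fold: "foldr (\<otimes>) (replicate k p) \<one> = p [^] k" for k
    using p by (induction k) (simp_all add: m_comm)
  have "x 0 = p [^] k \<otimes> x k" for k
  proof (induction k)
    case (Suc k)
    then show ?case using p x(1)[of "Suc k"] by (simp add: x(2)[of k] m_assoc)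
  qed (use x(1) in simp)
  moreover have "x 0 = p [^] length fs" using fs(2) fold[of "length fs"] by (simp add: rep factors_def)
  ultimately have "p [^] length fs \<otimes> x (length fs) = p [^] length fs \<otimes> \<one>" using p by simp
  then have "x (length fs) = \<one>"
    using l_cancel[of "p [^] length fs" "x (length fs)" \<one>] p x(1)[of "length fs"] by simp
  then show False using x_nonunit by simp
qed

end

section \<open>The additive monoid of natural numbers has all seven properties\<close>

text \<open>The natural numbers are transported along an injection \<open>e\<close>, because the
  property in question is fixed on monoids over one given type.\<close>

definition nat_monoid :: "(nat \<Rightarrow> 'a) \<Rightarrow> 'a monoid" where
  "nat_monoid e = \<lparr>carrier = range e, mult = (\<lambda>x y. e (inv_into UNIV e x + inv_into UNIV e y)), one = e 0\<rparr>"

locale nat_copy =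
  fixes e :: "nat \<Rightarrow> 'a" and N :: "'a monoid" (structure)
  assumes inj: "inj e"
  defines N_def: "N \<equiv> nat_monoid e"
begin

lemma carrier_N: "carrier N = range e"
  and one_N: "\<one> = e 0"
  and mult_N: "e m \<otimes> e n = e (m + n)"
  using inj by (simp_all add: N_def nat_monoid_def)

lemma e_eq_iff: "e m = e n \<longleftrightarrow> m = n"
  using inj by (simp add: inj_eq)

lemma e_closed: "e n \<in> carrier N"
  by (simp add: carrier_N)

sublocale comm_monoid_cancel N
  by (intro comm_monoid_cancelI comm_monoidI)
    (auto simp: carrier_N one_N mult_N e_eq_iff add.assoc add.commute)

lemma Units_N: "Units N = {e 0}"
  by (auto simp: Units_def carrier_N one_N mult_N e_eq_iff)

lemma irreducible_N_iff: "irreducible N (e n) \<longleftrightarrow> n = 1"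
proof
  assume "irreducible N (e n)"
  then have nonunit: "e n \<noteq> e 0"
    and split: "\<And>k l. e n = e k \<otimes> e l \<Longrightarrow> e k = e 0 \<or> e l = e 0"
    by (auto simp: irreducible_iff_atom Units_N e_closed)
  from nonunit have n: "n \<noteq> 0" by metis
  from n have "e n = e 1 \<otimes> e (n - 1)" by (simp add: mult_N)
  from split[OF this] show "n = 1" using n by (simp add: e_eq_iff)
next
  assume "n = 1"
  then show "irreducible N (e n)"
    by (auto simp: irreducible_iff_atom Units_N e_closed carrier_N mult_N e_eq_iff)
qed

text \<open>The only atom is \<open>e 1\<close>, so the length of a factorization determines both
  the list and its product. All five factorization properties follow from this.\<close>

lemma factorizations_N: "factorizations N (e n) = {replicate n (e 1)}"
proof -
  have fold: "foldr (\<otimes>) (replicate k (e 1)) \<one> = e k" for k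
    by (induction k) (simp_all add: one_N mult_N)
  have "fs = replicate n (e 1)" if "factors N fs (e n)" "set fs \<subseteq> carrier N" for fs
  proof -
    have "x = e 1" if "x \<in> set fs" for x
    proof -
      obtain k where "x = e k" using \<open>x \<in> set fs\<close> \<open>set fs \<subseteq> carrier N\<close> by (auto simp: carrier_N)
      then show ?thesis
        using \<open>x \<in> set fs\<close> \<open>factors N fs (e n)\<close> irreducible_N_iff[of k] by (auto simp: factors_def)
    qed
    then have fs: "replicate (length fs) (e 1) = fs"
      by (simp add: replicate_length_same)
    then have "e (length fs) = e n"
      using fold[of "length fs"] that by (simp add: factors_def)
    then show ?thesis using fs by (simp add: e_eq_iff)
  qed
  moreover have "factors N (replicate n (e 1)) (e n)"
    using fold irreducible_N_iff[of 1] by (simp add: factors_def del: foldr_replicate)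
  ultimately show ?thesis by (auto simp: factorizations_def e_closed)
qed

lemma atomic_N: "atomic N"
  by (auto simp: atomic_def carrier_N factorizations_N)

lemma BF_N: "BF N"
  using atomic_N by (auto simp: BF_def lengths_def carrier_N factorizations_N)

lemma FF_N: "FF N"
  using atomic_N by (auto simp: FF_def quotient_def carrier_N factorizations_N)

lemma half_factorial_N: "half_factorial N"
  using atomic_N by (auto simp: half_factorial_def lengths_def carrier_N factorizations_N)

lemma factorial_monoid_N: "factorial_monoid N"
  using atomic_N by (auto simp: factorial_monoid_iff carrier_N factorizations_N)

lemma emb_e: "emb N (e n) = Defs.frac N (e n) (e 0)"
  by (simp add: emb_def one_N)

lemma frac_in_emb_iff: "Defs.frac N (e m) (e n) \<in> emb N ` carrier N \<longleftrightarrow> n \<le> m"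
  by (auto simp: emb_e image_iff carrier_N frac_eq_iff e_closed mult_N e_eq_iff le_iff_add add.commute)

lemma frac_pow: "Defs.frac N (e m) (e n) [^]\<^bsub>quot_group N\<^esub> k = Defs.frac N (e (k * m)) (e (k * n))"
  by (induction k) (simp_all add: one_N frac_one frac_mult e_closed mult_N add.commute)

lemma completely_integrally_closed_N: "completely_integrally_closed N"
  unfolding completely_integrally_closed_def
proof (intro ballI impI)
  fix x assume "x \<in> carrier (quot_group N)"
  then obtain m n where x: "x = Defs.frac N (e m) (e n)"
    by (elim quot_group_cases) (auto simp: carrier_N)
  assume "\<exists>c\<in>carrier N. \<forall>k::nat. emb N c \<otimes>\<^bsub>quot_group N\<^esub> x [^]\<^bsub>quot_group N\<^esub> k \<in> emb N ` carrier N"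
  then obtain c where "\<And>k::nat. emb N (e c) \<otimes>\<^bsub>quot_group N\<^esub> x [^]\<^bsub>quot_group N\<^esub> k \<in> emb N ` carrier N"
    by (auto simp: carrier_N)
  \<comment> \<open>The exponent is chosen one larger than \<open>c\<close>, so that
    \<open>c\<close> is too small to make up for a deficit of even one per factor.\<close>
  from this[of "Suc c"] have "Suc c * n \<le> c + Suc c * m"
    unfolding x frac_pow emb_e
    by (simp add: frac_mult e_closed mult_N frac_in_emb_iff del: mult_Suc)
  then have "Suc c * n < Suc c * Suc m" by simp
  then have "n \<le> m" unfolding mult_less_cancel1 by simp
  then show "x \<in> emb N ` carrier N" by (simp add: x frac_in_emb_iff)
qed

text \<open>Take the least exponent occurring anywhere in the chain. A member containing it contains
  all larger exponents by absorption, hence every other member, and the chain is constant from there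
  on.\<close>

lemma v_noetherian_N: "v_noetherian N"
  unfolding v_noetherian_def
proof (intro allI impI, elim conjE)
  fix X assume v: "\<forall>n. v_ideal N (X n)" and asc: "\<forall>n. X n \<subseteq> X (Suc n)"
  have mono: "X k \<subseteq> X l" if "k \<le> l" for k l
    using lift_Suc_mono_le[of X] asc that by blast
  have "X k \<subseteq> emb N ` range e" for k
    using v by (simp add: v_ideal_def carrier_N)
  then have XE: "\<exists>n. z = emb N (e n)" if "z \<in> X k" for z k
    using that by blast
  show "\<exists>n. \<forall>m\<ge>n. X m = X n"
  proof (cases "\<exists>n k. emb N (e n) \<in> X k")
    case False
    \<comment> \<open>Empty v-ideals are permitted, so the chain without any exponent is treated
      apart.\<close>
    then have "X k = {}" for k using XE by blast
    then show ?thesis by simp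
  next
    case True
    define m where "m = (LEAST n. \<exists>k. emb N (e n) \<in> X k)"
    obtain k where k: "emb N (e m) \<in> X k"
      unfolding m_def using LeastI_ex[OF True] by blast
    have "X l \<subseteq> X k" for l
    proof
      fix z assume "z \<in> X l"
      then obtain n where n: "z = emb N (e n)" "emb N (e n) \<in> X l" using XE by blast
      then have "m \<le> n" unfolding m_def by (blast intro: Least_le)
      then have "z = emb N (e m) \<otimes>\<^bsub>quot_group N\<^esub> emb N (e (n - m))"
        by (simp add: n(1) e_closed mult_N flip: hom_mult[OF emb_hom])
      then show "z \<in> X k" using v_ideal_mult_closed[OF v[rule_format] k e_closed] by simp
    qed
    then show ?thesis using mono by blast
  qed
qed

lemma krull_N: "krull N"
  by (simp add: krull_def v_noetherian_N completely_integrally_closed_N)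

end

section \<open>The nonstandard model and the conclusion\<close>

text \<open>A monoid that is neither atomic nor v-Noetherian thus refutes all seven properties at
  once.\<close>

lemma atomic_or_v_noetherian:
  assumes "P \<in> {atomic, BF, FF, half_factorial, factorial_monoid, v_noetherian, krull}"
    and "P H" "comm_monoid_cancel H"
  shows "atomic H \<or> v_noetherian H"
  using assms comm_monoid_cancel.factorial_monoid_iff[of H]
  by (auto simp: BF_def FF_def half_factorial_def krull_def)

lemma exists_nonstandard_nat_monoid:
  fixes e :: "nat \<Rightarrow> 'a"
  assumes inj: "inj e"
  obtains K :: "'a monoid" where "comm_monoid_cancel K"
    "\<And>\<phi>. sentence \<phi> \<Longrightarrow> K \<Turnstile> \<phi> \<longleftrightarrow> nat_monoid e \<Turnstile> \<phi>"
    "\<not> atomic K" "\<not> v_noetherian K"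
proof -
  interpret N: nat_copy e "nat_monoid e" using inj by unfold_locales
  \<comment> \<open>Position 0 holds the constant generator and position \<open>Suc j\<close> the
    sequence with exponent \<open>i - j\<close>. Truncated subtraction distorts it only for finitely
    many \<open>i\<close>, which \<open>U\<close> ignores because it lies below
    \<open>sequentially\<close>.\<close>
  define b where "b k i = (case k of 0 \<Rightarrow> e 1 | Suc j \<Rightarrow> e (i - j))" for k i
  have b_closed: "b k i \<in> carrier (nat_monoid e)" for k i
    by (simp add: b_def N.e_closed split: nat.split)
  obtain U :: "nat filter" where U: "U \<noteq> bot" "U \<le> sequentially"
    and ultra: "\<And>P. eventually P U \<or> eventually (\<lambda>i. \<not> P i) U"
    using ex_ultrafilter_le[OF sequentially_bot] by blast
  have "infinite (UNIV :: 'a set)" using inj by (auto simp: infinite_iff_countable_subset)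
  then obtain K :: "'a monoid" and c where K: "comm_monoid_cancel K" and c: "range c \<subseteq> carrier K"
    and los: "\<And>\<phi>. holds K c \<phi> \<longleftrightarrow> (\<forall>\<^sub>F i in U. holds (nat_monoid e) (\<lambda>k. b k i) \<phi>)"
    by (rule elementary_hull_exists[OF _ N.comm_monoid_cancel_axioms b_closed U(1) ultra]) (rule that)
  interpret K: comm_monoid_cancel K by (rule K)
  have sent: "K \<Turnstile> \<phi> \<longleftrightarrow> nat_monoid e \<Turnstile> \<phi>" if "sentence \<phi>" for \<phi>
  proof -
    have "holds (nat_monoid e) (\<lambda>k. b k i) \<phi> \<longleftrightarrow> nat_monoid e \<Turnstile> \<phi>" for i
      using b_closed by (intro sentence_satisfies_iff[OF that, symmetric]) blast
    then show ?thesis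
      using los[of \<phi>] U(1) by (simp add: sentence_satisfies_iff[OF that c])
  qed
  define x where "x k = c (Suc k)" for k
  have c_closed: "c k \<in> carrier K" for k using c by blast
  then have x_closed: "x k \<in> carrier K" for k by (simp add: x_def)
  have step: "x k = c 0 \<otimes>\<^bsub>K\<^esub> x (Suc k)" for k
  proof -
    \<comment> \<open>The bound is \<open>Suc k\<close>, since \<open>i - k\<close> must be positive
      for one generator to split off.\<close>
    have "\<forall>\<^sub>F i in U. Suc k \<le> i"
      using U(2) eventually_ge_at_top by (rule filter_leD)
    then have "\<forall>\<^sub>F i in U. holds (nat_monoid e) (\<lambda>k. b k i)
        (Eq (Var (Suc k)) (Mult (Var 0) (Var (Suc (Suc k)))))"
      by (rule eventually_mono) (simp add: b_def N.mult_N Suc_diff_Suc Suc_le_eq)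
    from this[folded los] show ?thesis by (simp add: x_def)
  qed
  \<comment> \<open>Three formulas true at every index supply the other hypotheses on
    \<open>K\<close>: \<open>c 0\<close> is not the identity, a left factor of the identity is the
    identity, and \<open>c 0\<close> divides every other element.\<close>
  have "\<forall>\<^sub>F i in U. holds (nat_monoid e) (\<lambda>k. b k i) (Neg (Eq (Var 0) One))"
    by (simp add: b_def N.one_N N.e_eq_iff)
  from this[folded los] have p: "c 0 \<noteq> \<one>\<^bsub>K\<^esub>" by simp
  have "\<forall>\<^sub>F i in U. holds (nat_monoid e) (\<lambda>k. b k i)
      (Forall 1 (Forall 2 (Neg (Conj (Eq (Mult (Var 1) (Var 2)) One) (Neg (Eq (Var 1) One))))))"
    by (auto simp: N.carrier_N N.mult_N N.one_N N.e_eq_iff)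
  from this[folded los] have "y = \<one>\<^bsub>K\<^esub>" if "y \<in> carrier K" "z \<in> carrier K" "y \<otimes>\<^bsub>K\<^esub> z = \<one>\<^bsub>K\<^esub>" for y z
    using that by auto
  then have reduced: "Units K = {\<one>\<^bsub>K\<^esub>}" by (auto simp: Units_def)
  have "\<forall>\<^sub>F i in U. holds (nat_monoid e) (\<lambda>k. b k i)
      (Forall 1 (Neg (Conj (Neg (Eq (Var 1) One)) (Forall 2 (Neg (Eq (Var 1) (Mult (Var 0) (Var 2))))))))"
  proof (rule always_eventually, rule allI)
    fix i
    have "\<exists>k. e n = e 1 \<otimes>\<^bsub>nat_monoid e\<^esub> e k" if "n \<noteq> 0" for n
      using that by (intro exI[of _ "n - 1"]) (simp add: N.mult_N)
    then show "holds (nat_monoid e) (\<lambda>k. b k i)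
      (Forall 1 (Neg (Conj (Neg (Eq (Var 1) One)) (Forall 2 (Neg (Eq (Var 1) (Mult (Var 0) (Var 2))))))))"
      by (auto simp: N.carrier_N N.one_N N.e_eq_iff b_def)
  qed
  from this[folded los] have dvd: "c 0 divides\<^bsub>K\<^esub> y" if "y \<in> carrier K" "y \<noteq> \<one>\<^bsub>K\<^esub>" for y
    using that by (auto simp: factor_def)
  have "\<not> atomic K"
    by (rule K.not_atomic_if_descending[of "c 0" x, OF c_closed p reduced dvd x_closed step])
  moreover have "\<not> v_noetherian K"
    by (rule K.not_v_noetherian_if_descending[of "c 0" x, OF c_closed _ x_closed step]) (simp add: reduced p)
  ultimately show thesis using K sent by (intro that)
qed

theorem proposition4p1:
  fixes P :: "'a monoid \<Rightarrow> bool"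
  assumes "infinite (UNIV :: 'a set)"
    and "P \<in> {atomic, BF, FF, half_factorial, factorial_monoid, v_noetherian, krull}"
  shows "\<not> (\<exists>\<phi>. sentence \<phi> \<and> (\<forall>H :: 'a monoid. comm_monoid_cancel H \<longrightarrow> (H \<Turnstile> \<phi> \<longleftrightarrow> P H)))"
proof
  assume "\<exists>\<phi>. sentence \<phi> \<and> (\<forall>H :: 'a monoid. comm_monoid_cancel H \<longrightarrow> (H \<Turnstile> \<phi> \<longleftrightarrow> P H))"
  then obtain \<phi> where \<phi>: "sentence \<phi>"
    and P: "\<And>H :: 'a monoid. comm_monoid_cancel H \<Longrightarrow> H \<Turnstile> \<phi> \<longleftrightarrow> P H" by blast
  obtain e :: "nat \<Rightarrow> 'a" where "inj e"
    using infinite_countable_subset[OF assms(1)] by blast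
  then interpret N: nat_copy e "nat_monoid e" by unfold_locales
  obtain K :: "'a monoid" where K: "comm_monoid_cancel K" "K \<Turnstile> \<phi> \<longleftrightarrow> nat_monoid e \<Turnstile> \<phi>"
    "\<not> atomic K" "\<not> v_noetherian K"
    by (rule exists_nonstandard_nat_monoid[OF \<open>inj e\<close>]) (use \<phi> in blast)
  have "P (nat_monoid e)"
    using assms(2) N.atomic_N N.BF_N N.FF_N N.half_factorial_N N.factorial_monoid_N
      N.v_noetherian_N N.krull_N by (elim insertE emptyE) simp_all
  then have "P K" using K P[OF K(1)] P[OF N.comm_monoid_cancel_axioms] by simp
  then show False using atomic_or_v_noetherian[OF assms(2)] K by blast
qed

end
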